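(* Let $k\ge 1$ and $t\ge 0$. There is a bijection between $2(m+t)^k$-parking functions and extended non-initial acyclic deterministic finite automata with $t$ extra absorbing states over an alphabet of $k$ symbols, preserving degree: for every $n\ge 0$ and every set $N$ with $n$ elements, the set of $\chi$-parking functions on $N$ with $\chi(m)=2(m+t)^k$ is in bijection with the set $\mathcal{E}^{k,t}_n$ of extended non-initial ADFA with state set $N$ and $t$ extra absorbing states over an alphabet of $k$ symbols.
   Context: Parking functions. For a non-decreasing $\chi:\mathbb{N}_+\to\mathbb{N}$ and a finite set $N$ with $n$ elements, a $\chi$-parking function on $N$ is a function $f:N\to\mathbb{N}_+$ such that $\#f^{-1}(\{1,\dots,\chi(j)\})\ge j$ for all $j\in\{1,\dots,n\}$. Automata. Let $\Sigma$ be an alphabet of $k$ symbols, $N$ a finite set (the labeled states), $T$ a fixed set of $t$ extra absorbing states and $\emptyset$ a special symbol (the absorbing state), with $N$, $T$, $\{\emptyset\}$ pairwise disjoint. An extended non-initial ADFA with state set $N$ and extra absorbing states $T$ is given by a pair $(A,\delta)$ with $A\subseteq N$ (accepting states) and $\delta:N\times\Sigma\to N\cup\{\emptyset\}\cup T$ (transition function) that is acyclic: no non-empty sequence of transitions leads from a state $q\in N$ back to itself. The elements of $T\cup\{\emptyset\}$ have no outgoing transitions (they are absorbing). Automata are labeled objects, not considered up to isomorphism. *)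

theory Defs
  imports Complex_Main "HOL-Library.FuncSet"
begin

(* Functions on N are taken extensional, so that each function N -> {1, 2, ...} is
   represented exactly once. Only the values of chi on positive arguments matter; the
   notion is intended for chi non-decreasing and N finite. *)
definition parking_functions :: "(nat \<Rightarrow> nat) \<Rightarrow> 'a set \<Rightarrow> ('a \<Rightarrow> nat) set" where
  "parking_functions \<chi> N =
     {f \<in> N \<rightarrow>\<^sub>E {1..}. \<forall>j\<in>{1..card N}. card {x \<in> N. f x \<in> {1..\<chi> j}} \<ge> j}"

lemma mono_two_mult_power: "mono (\<lambda>m::nat. 2 * (m + t) ^ k)"
  by (intro monoI mult_left_mono power_mono) auto

definition transitions :: "'a set \<Rightarrow> 's set \<Rightarrow> ('a \<times> 's \<Rightarrow> 'a) \<Rightarrow> 'a rel" where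
  "transitions N \<Sigma> \<delta> = {(q, \<delta> (q, a)) | q a. q \<in> N \<and> a \<in> \<Sigma>}"

(* N are the states, e is the special absorbing symbol, T the extra absorbing states.
   All of them live in one type; disjointness is assumed where this is used.
   Transition functions are again extensional, so that distinct pairs are distinct automata. *)
definition extended_ADFA :: "'s set \<Rightarrow> 'a set \<Rightarrow> 'a \<Rightarrow> 'a set \<Rightarrow> ('a set \<times> ('a \<times> 's \<Rightarrow> 'a)) set" where
  "extended_ADFA \<Sigma> T e N =
     {(A, \<delta>). A \<subseteq> N \<and> \<delta> \<in> N \<times> \<Sigma> \<rightarrow>\<^sub>E N \<union> {e} \<union> T \<and>
              (\<forall>q\<in>N. (q, q) \<notin> (transitions N \<Sigma> \<delta>)\<^sup>+)}"

end

theory Submission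
  imports Defs "HOL-Computational_Algebra.Polynomial"
begin

text \<open>
  Both families are finite, so it suffices that they have the same size. Both counting functions
  \<open>F\<close> turn out to satisfy the same signed recurrence over subsets,
  \<open>(\<Sum>M\<in>Pow N. F M * (- \<chi> (card M + 1)) ^ card (N - M)) = 0 ^ card N\<close>, which determines
  \<open>F N\<close> from the values of \<open>F\<close> on proper subsets (\<open>subset_recurrence_unique\<close>).

  For parking functions the recurrence is the value at \<open>x = 0\<close> of a polynomial identity of
  Goncarov type. Every function from \<open>N\<close> to \<open>{1..x}\<close> has exactly one subset \<open>M\<close> of \<open>N\<close>
  on which it is a parking function and outside of which all values exceed
  \<open>\<chi> (card M + 1)\<close>. Counting functions by this \<open>M\<close> gives
  \<open>x ^ card N = (\<Sum>M\<in>Pow N. F M * (x - \<chi> (card M + 1)) ^ card (N - M))\<close> for all large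
  integers \<open>x\<close>, hence as polynomials in \<open>x\<close> (\<open>parking_functions_recurrence\<close>).

  For automata the recurrence is inclusion-exclusion over sets of sources, that is, of states
  without incoming transitions. An automaton whose states in \<open>N - L\<close> are all sources consists
  of an arbitrary automaton on \<open>L\<close> together with, for each state in \<open>N - L\<close>, an acceptance bit
  and one target in \<open>L\<close> or among the \<open>t + 1\<close> absorbing states for each of the \<open>k\<close> letters:
  \<open>2 * (card L + 1 + t) ^ k = \<chi> (card L + 1)\<close> choices. Since a non-empty acyclic automaton
  has a source, the alternating sum vanishes unless \<open>N\<close> is empty
  (\<open>extended_ADFA_recurrence\<close>).
\<close>

section \<open>Gluing functions and a uniqueness principle\<close>

text \<open>
  Both decompositions below cut a function on a disjoint union into its two restrictions, which
  can be chosen independently.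
\<close>

lemma card_glued_functions:
  assumes disj: "A \<inter> B = {}" and P: "P \<subseteq> extensional A" and Q: "Q \<subseteq> extensional B"
  shows "card {f \<in> extensional (A \<union> B). restrict f A \<in> P \<and> restrict f B \<in> Q} = card P * card Q"
proof -
  have "bij_betw (\<lambda>f. (restrict f A, restrict f B))
          {f \<in> extensional (A \<union> B). restrict f A \<in> P \<and> restrict f B \<in> Q} (P \<times> Q)"
  proof (rule bij_betw_byWitness[where f' = "\<lambda>(g, h). \<lambda>x\<in>A \<union> B. if x \<in> A then g x else h x"])
    show "\<forall>f\<in>{f \<in> extensional (A \<union> B). restrict f A \<in> P \<and> restrict f B \<in> Q}.
      (\<lambda>(g, h). \<lambda>x\<in>A \<union> B. if x \<in> A then g x else h x) (restrict f A, restrict f B) = f"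
      by (auto simp: fun_eq_iff extensional_def)
    have glue: "restrict (\<lambda>x\<in>A \<union> B. if x \<in> A then g x else h x) A = g"
        "restrict (\<lambda>x\<in>A \<union> B. if x \<in> A then g x else h x) B = h" 
      if "g \<in> P" "h \<in> Q" for g h
      using that disj P Q by (fastforce simp: fun_eq_iff extensional_def)+
    then show "\<forall>p\<in>P \<times> Q. (\<lambda>f. (restrict f A, restrict f B))
      ((\<lambda>(g, h). \<lambda>x\<in>A \<union> B. if x \<in> A then g x else h x) p) = p"
      by auto
    show "(\<lambda>(g, h). \<lambda>x\<in>A \<union> B. if x \<in> A then g x else h x) ` (P \<times> Q) \<subseteq>
      {f \<in> extensional (A \<union> B). restrict f A \<in> P \<and> restrict f B \<in> Q}"
      using glue by auto
  qed auto
  from bij_betw_same_card[OF this] show ?thesis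
    by (simp add: card_cartesian_product)
qed

text \<open>
  The term for \<open>L = M\<close> has coefficient \<open>1\<close>, so the system is triangular with respect to
  inclusion and can be solved from the empty set upwards.
\<close>

lemma subset_recurrence_unique:
  fixes F G :: "'a set \<Rightarrow> 'b::comm_ring_1"
  assumes "finite N"
    and "\<And>M. M \<subseteq> N \<Longrightarrow> (\<Sum>L\<in>Pow M. F L * c L M) = (\<Sum>L\<in>Pow M. G L * c L M)"
    and "\<And>M. c M M = 1"
  shows "F N = G N"
  using assms(1,2)
proof (induction N rule: finite_psubset_induct)
  case (psubset N)
  have split: "(\<Sum>L\<in>Pow N. H L * c L N) = H N + (\<Sum>L\<in>Pow N - {N}. H L * c L N)" 
    for H :: "'a set \<Rightarrow> 'b"
    using psubset.hyps assms(3) by (subst sum.remove[of _ N]) auto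
  have "(\<Sum>L\<in>Pow N - {N}. F L * c L N) = (\<Sum>L\<in>Pow N - {N}. G L * c L N)"
  proof (rule sum.cong[OF refl])
    fix L assume "L \<in> Pow N - {N}"
    then have "F L = G L"
      using psubset.prems by (intro psubset.IH) auto
    then show "F L * c L N = G L * c L N" by simp
  qed
  with psubset.prems[of N] show ?case by (simp add: split)
qed

section \<open>Parking functions\<close>

text \<open>
  The parking condition for \<open>j = card N\<close> says that all elements of \<open>N\<close> have values in
  \<open>{1..\<chi> (card N)}\<close>. Besides finiteness, this gives the upper half of the separation between
  the parked part of a function and the rest.
\<close>

lemma parking_functions_le:
  assumes "finite N" "f \<in> parking_functions \<chi> N" "x \<in> N"
  shows "f x \<le> \<chi> (card N)"
proof -
  have "card N \<in> {1..card N}"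
    using assms by (auto simp: Suc_le_eq card_gt_0_iff)
  then have "card N \<le> card {x \<in> N. f x \<in> {1..\<chi> (card N)}}"
    using assms(2) unfolding parking_functions_def by blast
  then have "{x \<in> N. f x \<in> {1..\<chi> (card N)}} = N"
    using assms(1) by (intro card_seteq) auto
  then show ?thesis using assms(3) by auto
qed

lemma finite_parking_functions:
  assumes "finite N"
  shows "finite (parking_functions \<chi> N)"
proof (rule finite_subset)
  show "parking_functions \<chi> N \<subseteq> N \<rightarrow>\<^sub>E {1..\<chi> (card N)}"
  proof
    fix f assume f: "f \<in> parking_functions \<chi> N"
    then have "f \<in> N \<rightarrow>\<^sub>E {1..}" by (simp add: parking_functions_def)
    with parking_functions_le[OF assms f] show "f \<in> N \<rightarrow>\<^sub>E {1..\<chi> (card N)}"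
      by (simp add: PiE_iff)
  qed
  show "finite (N \<rightarrow>\<^sub>E {1..\<chi> (card N)})"
    using assms by (intro finite_PiE) auto
qed

text \<open>
  \<open>M\<close> is the part of \<open>N\<close> that \<open>f\<close> manages to park: on \<open>M\<close> all conditions hold, and no element
  outside \<open>M\<close> helps with the next one, for \<open>j = card M + 1\<close>. Writing this through restrictions
  makes the count a product.
\<close>

definition parks_exactly :: "(nat \<Rightarrow> nat) \<Rightarrow> 'a set \<Rightarrow> nat \<Rightarrow> 'a set \<Rightarrow> ('a \<Rightarrow> nat) set" where
  "parks_exactly \<chi> N x M =
     {f \<in> extensional N. restrict f M \<in> parking_functions \<chi> M \<and>
        restrict f (N - M) \<in> N - M \<rightarrow>\<^sub>E {Suc (\<chi> (Suc (card M)))..x}}"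

lemma card_parks_exactly:
  assumes "finite N" "M \<subseteq> N"
  shows "card (parks_exactly \<chi> N x M) =
           card (parking_functions \<chi> M) * (x - \<chi> (Suc (card M))) ^ card (N - M)"
proof -
  have "card {f \<in> extensional (M \<union> (N - M)). restrict f M \<in> parking_functions \<chi> M \<and>
        restrict f (N - M) \<in> N - M \<rightarrow>\<^sub>E {Suc (\<chi> (Suc (card M)))..x}}
      = card (parking_functions \<chi> M) * card (N - M \<rightarrow>\<^sub>E {Suc (\<chi> (Suc (card M)))..x})"
    by (rule card_glued_functions) (auto simp: parking_functions_def PiE_iff)
  moreover have "M \<union> (N - M) = N" using assms(2) by auto
  ultimately show ?thesis
    using assms(1) by (simp add: parks_exactly_def card_funcsetE)
qed

text \<open>
  Values on \<open>M\<close> are at most \<open>\<chi> (card M)\<close>, those off \<open>M\<close> exceed \<open>\<chi> (card M + 1)\<close>; so \<open>M\<close> is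
  a sublevel set of \<open>f\<close>, determined by its cardinality.
\<close>

lemma parks_exactly_initial:
  assumes "mono \<chi>" "finite N" "M \<subseteq> N" "f \<in> parks_exactly \<chi> N x M"
  shows "M = {y \<in> N. f y \<le> \<chi> (Suc (card M))}"
proof -
  have "f y \<le> \<chi> (Suc (card M))" if "y \<in> M" for y
  proof -
    have "restrict f M \<in> parking_functions \<chi> M"
      using assms(4) by (simp add: parks_exactly_def)
    from parking_functions_le[OF finite_subset[OF assms(3,2)] this that]
    have "f y \<le> \<chi> (card M)" using that by simp
    also have "\<dots> \<le> \<chi> (Suc (card M))"
      by (rule monoD[OF assms(1)]) simp
    finally show ?thesis .
  qed
  moreover have "f y > \<chi> (Suc (card M))" if "y \<in> N - M" for y
    using assms(4) that by (simp add: parks_exactly_def PiE_iff Suc_le_eq)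
  ultimately show ?thesis using assms(3) by force
qed

text \<open>
  If \<open>L'\<close> were larger than \<open>L\<close>, the parking condition on \<open>L'\<close> for \<open>j = card L + 1\<close> would
  require more than \<open>card L\<close> elements of value at most \<open>\<chi> (card L + 1)\<close>, but these all lie
  in \<open>L\<close>. Hence the cardinality, and with it the set, is unique.
\<close>

lemma parks_exactly_unique:
  assumes "mono \<chi>" "finite N" and M: "M \<subseteq> N" "f \<in> parks_exactly \<chi> N x M"
    and M': "M' \<subseteq> N" "f \<in> parks_exactly \<chi> N x M'"
  shows "M = M'"
proof -
  have le: "card L' \<le> card L"
    if "L \<subseteq> N" "f \<in> parks_exactly \<chi> N x L" "L' \<subseteq> N" "f \<in> parks_exactly \<chi> N x L'" for L L'
  proof (rule ccontr)
    assume "\<not> card L' \<le> card L"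
    then have "Suc (card L) \<in> {1..card L'}" by auto
    moreover have "restrict f L' \<in> parking_functions \<chi> L'"
      using that(4) by (simp add: parks_exactly_def)
    ultimately have "Suc (card L) \<le> card {y \<in> L'. restrict f L' y \<in> {1..\<chi> (Suc (card L))}}"
      unfolding parking_functions_def by blast
    also have "\<dots> \<le> card L"
      using parks_exactly_initial[OF assms(1,2) that(1,2)] that assms(2)
      by (intro card_mono) (auto intro: finite_subset)
    finally show False by simp
  qed
  then have "card M = card M'"
    using M M' by (meson le_antisym)
  with parks_exactly_initial[OF assms(1,2) M] parks_exactly_initial[OF assms(1,2) M']
  show ?thesis by simp
qed

text \<open>
  The size of the parked part is the least \<open>j\<close> for which the condition for \<open>j + 1\<close> fails when
  tested on all of \<open>N\<close>; the conditions up to \<open>j\<close> then hold by minimality, and the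
  condition for \<open>j\<close> together with the failure for \<open>j + 1\<close> forces the sublevel set at
  \<open>\<chi> (j + 1)\<close> to have exactly \<open>j\<close> elements.
\<close>

lemma parks_exactly_exists:
  assumes mono: "mono \<chi>" and fin: "finite N" and f: "f \<in> N \<rightarrow>\<^sub>E {1..x}"
  obtains M where "M \<subseteq> N" "f \<in> parks_exactly \<chi> N x M"
proof -
  define B where "B j = {y \<in> N. f y \<le> \<chi> j}" for j
  define j where "j = (LEAST j. card (B (Suc j)) \<le> j)"
  have "card (B (Suc (card N))) \<le> card N"
    using fin by (auto simp: B_def intro: card_mono)
  then have upper: "card (B (Suc j)) \<le> j"
    unfolding j_def by (rule LeastI)
  have lower: "i \<le> card (B i)" if "i \<in> {1..j}" for i
  proof -
    from that have "i - 1 < j" by auto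
    then have "\<not> card (B (Suc (i - 1))) \<le> i - 1"
      unfolding j_def by (rule not_less_Least)
    with that show ?thesis by auto
  qed
  define M where "M = B (Suc j)"
  have "M \<subseteq> N" by (auto simp: M_def B_def)
  have sub: "B i \<subseteq> M" if "i \<le> j" for i
    using monoD[OF mono, of i "Suc j"] that by (auto simp: M_def B_def)
  have "j \<le> card M"
  proof (cases "j = 0")
    case False
    then have "j \<le> card (B j)" by (intro lower) auto
    also have "\<dots> \<le> card M"
      using sub[of j] fin \<open>M \<subseteq> N\<close> by (intro card_mono) (auto intro: finite_subset)
    finally show ?thesis .
  qed simp
  with upper have card_M: "card M = j" by (simp add: M_def)
  have "restrict f M \<in> parking_functions \<chi> M"
    unfolding parking_functions_def
  proof (intro CollectI conjI ballI)
    show "restrict f M \<in> M \<rightarrow>\<^sub>E {1..}"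
      using f \<open>M \<subseteq> N\<close> by (auto simp: PiE_iff)
    fix i assume i: "i \<in> {1..card M}"
    then have "{y \<in> M. restrict f M y \<in> {1..\<chi> i}} = B i"
      using sub[of i] f \<open>M \<subseteq> N\<close> card_M by (auto simp: B_def PiE_iff)
    then show "i \<le> card {y \<in> M. restrict f M y \<in> {1..\<chi> i}}"
      using lower i card_M by simp
  qed
  moreover have "restrict f (N - M) \<in> N - M \<rightarrow>\<^sub>E {Suc (\<chi> (Suc (card M)))..x}"
    using f card_M by (auto simp: M_def B_def PiE_iff)
  ultimately have "f \<in> parks_exactly \<chi> N x M"
    using f by (auto simp: parks_exactly_def PiE_iff)
  with \<open>M \<subseteq> N\<close> that show ?thesis by blast
qed

text \<open>
  The bound on \<open>x\<close> ensures that the parked part of a function automatically takes its values in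
  \<open>{1..x}\<close>.
\<close>

lemma power_eq_sum_parking_functions:
  assumes "mono \<chi>" "finite N" "\<chi> (Suc (card N)) \<le> x"
  shows "x ^ card N =
    (\<Sum>M\<in>Pow N. card (parking_functions \<chi> M) * (x - \<chi> (Suc (card M))) ^ card (N - M))"
proof -
  have sub: "parks_exactly \<chi> N x M \<subseteq> N \<rightarrow>\<^sub>E {1..x}" if "M \<subseteq> N" for M
  proof
    fix f assume f: "f \<in> parks_exactly \<chi> N x M"
    have "1 \<le> f y \<and> f y \<le> x" if y: "y \<in> N" for y
    proof (cases "y \<in> M")
      case True
      have "f y \<le> \<chi> (Suc (card M))"
        using parks_exactly_initial[OF assms(1,2) \<open>M \<subseteq> N\<close> f] True by blast
      also have "\<dots> \<le> \<chi> (Suc (card N))"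
        using assms(1,2) \<open>M \<subseteq> N\<close> by (intro monoD[OF assms(1)]) (auto intro: card_mono)
      finally have "f y \<le> x" using assms(3) by simp
      moreover have "restrict f M \<in> M \<rightarrow>\<^sub>E {1..}"
        using f by (auto simp: parks_exactly_def parking_functions_def)
      ultimately show ?thesis using True by (auto simp: PiE_iff)
    next
      case False
      then have "Suc (\<chi> (Suc (card M))) \<le> f y \<and> f y \<le> x"
        using f y by (simp add: parks_exactly_def PiE_iff)
      then show ?thesis by linarith
    qed
    then show "f \<in> N \<rightarrow>\<^sub>E {1..x}"
      using f by (auto simp: parks_exactly_def PiE_iff)
  qed
  have "N \<rightarrow>\<^sub>E {1..x} = (\<Union>M\<in>Pow N. parks_exactly \<chi> N x M)"
  proof
    show "N \<rightarrow>\<^sub>E {1..x} \<subseteq> (\<Union>M\<in>Pow N. parks_exactly \<chi> N x M)"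
    proof
      fix f assume "f \<in> N \<rightarrow>\<^sub>E {1..x}"
      then obtain M where "M \<subseteq> N" "f \<in> parks_exactly \<chi> N x M"
        using parks_exactly_exists[OF assms(1,2)] by blast
      then show "f \<in> (\<Union>M\<in>Pow N. parks_exactly \<chi> N x M)" by blast
    qed
  qed (use sub in blast)
  then have "x ^ card N = card (\<Union>M\<in>Pow N. parks_exactly \<chi> N x M)"
    using card_funcsetE[OF assms(2), of "{1..x}"] by simp
  also have "\<dots> = (\<Sum>M\<in>Pow N. card (parks_exactly \<chi> N x M))"
  proof (rule card_UN_disjoint)
    show "\<forall>M\<in>Pow N. finite (parks_exactly \<chi> N x M)"
    proof
      fix M assume "M \<in> Pow N"
      then show "finite (parks_exactly \<chi> N x M)"
        using assms(2) by (intro finite_subset[OF sub]) (auto intro: finite_PiE)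
    qed
    show "\<forall>M\<in>Pow N. \<forall>M'\<in>Pow N. M \<noteq> M' \<longrightarrow> 
        parks_exactly \<chi> N x M \<inter> parks_exactly \<chi> N x M' = {}"
      using parks_exactly_unique[OF assms(1,2)] by blast
  qed (use assms(2) in auto)
  also have "\<dots> = (\<Sum>M\<in>Pow N. card (parking_functions \<chi> M) * (x - \<chi> (Suc (card M))) ^ card (N - M))"
    using assms(2) by (intro sum.cong) (auto simp: card_parks_exactly)
  finally show ?thesis .
qed

text \<open>
  The preceding count is a polynomial identity in \<open>x\<close> valid at infinitely many integers, so it
  may be evaluated at \<open>x = 0\<close>, where it has no direct combinatorial meaning.
\<close>

lemma parking_functions_recurrence:
  assumes "mono \<chi>" "finite N"
  shows "(\<Sum>M\<in>Pow N. int (card (parking_functions \<chi> M)) *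
            (- int (\<chi> (Suc (card M)))) ^ card (N - M)) = 0 ^ card N"
proof -
  define p :: "int poly" where
    "p = (\<Sum>M\<in>Pow N. smult (int (card (parking_functions \<chi> M)))
            ([:- int (\<chi> (Suc (card M))), 1:] ^ card (N - M))) - monom 1 (card N)"
  have poly_p: "poly p x = (\<Sum>M\<in>Pow N. int (card (parking_functions \<chi> M)) *
            (x - int (\<chi> (Suc (card M)))) ^ card (N - M)) - x ^ card N" for x
    by (simp add: p_def poly_sum poly_monom)
  have "poly p (int x) = 0" if x: "\<chi> (Suc (card N)) \<le> x" for x
  proof -
    have "int (x ^ card N) = (\<Sum>M\<in>Pow N. int (card (parking_functions \<chi> M)) *
            int (x - \<chi> (Suc (card M))) ^ card (N - M))"
      by (subst power_eq_sum_parking_functions[OF assms x]) simp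
    also have "\<dots> = (\<Sum>M\<in>Pow N. int (card (parking_functions \<chi> M)) *
            (int x - int (\<chi> (Suc (card M)))) ^ card (N - M))"
    proof (rule sum.cong[OF refl])
      fix M assume "M \<in> Pow N"
      then have "\<chi> (Suc (card M)) \<le> \<chi> (Suc (card N))"
        using assms(2) by (intro monoD[OF assms(1)]) (auto intro: card_mono)
      with x show "int (card (parking_functions \<chi> M)) *
            int (x - \<chi> (Suc (card M))) ^ card (N - M) = int (card (parking_functions \<chi> M)) *
            (int x - int (\<chi> (Suc (card M)))) ^ card (N - M)"
        by (simp add: of_nat_diff)
    qed
    finally show ?thesis by (simp add: poly_p)
  qed
  then have "int ` {\<chi> (Suc (card N))..} \<subseteq> {x. poly p x = 0}" by auto
  moreover have "infinite (int ` {\<chi> (Suc (card N))..})"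
    by (subst finite_image_iff) (auto simp: infinite_Ici)
  ultimately have "p = 0"
    using poly_roots_finite finite_subset by blast
  then show ?thesis using poly_p[of 0] by simp
qed

section \<open>Acyclic automata\<close>

text \<open>
  Accepting states do not interact with acyclicity, so the transition functions are treated on
  their own, with \<open>Z\<close> collecting all absorbing states.
\<close>

definition acyclic_transitions :: "'s set \<Rightarrow> 'a set \<Rightarrow> 'a set \<Rightarrow> ('a \<times> 's \<Rightarrow> 'a) set" where
  "acyclic_transitions \<Sigma> Z N =
     {\<delta> \<in> N \<times> \<Sigma> \<rightarrow>\<^sub>E N \<union> Z. \<forall>q\<in>N. (q, q) \<notin> (transitions N \<Sigma> \<delta>)\<^sup>+}"

lemma extended_ADFA_eq: "extended_ADFA \<Sigma> T e N = Pow N \<times> acyclic_transitions \<Sigma> (insert e T) N"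
  by (auto simp: extended_ADFA_def acyclic_transitions_def)

lemma finite_acyclic_transitions:
  assumes "finite \<Sigma>" "finite Z" "finite N"
  shows "finite (acyclic_transitions \<Sigma> Z N)"
  by (rule finite_subset[where B = "N \<times> \<Sigma> \<rightarrow>\<^sub>E N \<union> Z"])
     (use assms in \<open>auto simp: acyclic_transitions_def intro: finite_PiE\<close>)

definition sources :: "'s set \<Rightarrow> 'a set \<Rightarrow> ('a \<times> 's \<Rightarrow> 'a) \<Rightarrow> 'a set" where
  "sources \<Sigma> N \<delta> = N - \<delta> ` (N \<times> \<Sigma>)"

text \<open>
  Restricted to \<open>N\<close>, the transition relation is finite and acyclic, hence well-founded, and a
  minimal element is a source.
\<close>

lemma ex_source:
  assumes "finite N" "N \<noteq> {}" "\<delta> \<in> acyclic_transitions \<Sigma> Z N"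
  shows "sources \<Sigma> N \<delta> \<noteq> {}"
proof -
  (* Transitions into absorbing states are discarded, so that r is a relation on N. *)
  define r where "r = transitions N \<Sigma> \<delta> \<inter> N \<times> N"
  have "acyclic r"
    unfolding acyclic_def
  proof (intro allI notI)
    fix q assume q: "(q, q) \<in> r\<^sup>+"
    from tranclD[OF this] obtain p where "(q, p) \<in> r" by blast
    then have "q \<in> N" by (simp add: r_def)
    moreover have "(q, q) \<in> (transitions N \<Sigma> \<delta>)\<^sup>+"
      using q by (rule trancl_mono) (simp add: r_def)
    ultimately show False
      using assms(3) by (auto simp: acyclic_transitions_def)
  qed
  moreover have "finite r"
    using assms(1) by (auto simp: r_def)
  ultimately have "wf r" by (rule finite_acyclic_wf[rotated])
  from wfE_min'[OF this assms(2)] obtain z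
    where "z \<in> N" and min: "\<And>y. (y, z) \<in> r \<Longrightarrow> y \<notin> N" by blast
  have "z \<notin> \<delta> ` (N \<times> \<Sigma>)"
  proof
    assume "z \<in> \<delta> ` (N \<times> \<Sigma>)"
    then obtain q a where "q \<in> N" "a \<in> \<Sigma>" "z = \<delta> (q, a)" by auto
    with \<open>z \<in> N\<close> have "(q, z) \<in> r" by (auto simp: r_def transitions_def)
    with min \<open>q \<in> N\<close> show False by blast
  qed
  with \<open>z \<in> N\<close> show ?thesis by (auto simp: sources_def)
qed

text \<open>
  A path never enters a source after its first vertex, so a path that starts in \<open>L\<close> uses only
  transitions out of \<open>L\<close>. Attaching new sources therefore creates no cycle.
\<close>

lemma trancl_avoids_sources:
  assumes path: "(p, q) \<in> (transitions N \<Sigma> \<delta>)\<^sup>+" and "p \<in> L" and src: "N - L \<subseteq> sources \<Sigma> N \<delta>"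
  shows "(p, q) \<in> (transitions L \<Sigma> \<delta>)\<^sup>+"
  using path
proof (induction rule: trancl_induct)
  case (base y)
  then show ?case
    using \<open>p \<in> L\<close> by (auto simp: transitions_def intro!: r_into_trancl)
next
  case (step y z)
  from step(1) have "y \<in> \<delta> ` (N \<times> \<Sigma>)"
    by (cases rule: trancl.cases) (auto simp: transitions_def)
  moreover from step(2) have "y \<in> N" by (auto simp: transitions_def)
  ultimately have "y \<in> L" using src by (auto simp: sources_def)
  then have "(y, z) \<in> transitions L \<Sigma> \<delta>"
    using step(2) by (auto simp: transitions_def)
  with step(3) show ?case by (rule trancl_into_trancl)
qed

lemma transitions_cong:
  "(\<And>q a. q \<in> L \<Longrightarrow> a \<in> \<Sigma> \<Longrightarrow> \<delta> (q, a) = \<delta>' (q, a)) \<Longrightarrow> transitions L \<Sigma> \<delta> = transitions L \<Sigma> \<delta>'"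
  unfolding transitions_def by force

text \<open>
  The transitions of prescribed sources are unconstrained, except that they must not lead into
  those sources: every cycle of the whole automaton already lies in \<open>L\<close>.
\<close>

lemma acyclic_transitions_with_sources:
  assumes "L \<subseteq> N" "N \<inter> Z = {}"
  shows "{\<delta> \<in> acyclic_transitions \<Sigma> Z N. N - L \<subseteq> sources \<Sigma> N \<delta>} =
    {\<delta> \<in> extensional (L \<times> \<Sigma> \<union> (N - L) \<times> \<Sigma>). 
       restrict \<delta> (L \<times> \<Sigma>) \<in> acyclic_transitions \<Sigma> Z L \<and>
       restrict \<delta> ((N - L) \<times> \<Sigma>) \<in> (N - L) \<times> \<Sigma> \<rightarrow>\<^sub>E L \<union> Z}" (is "?lhs = ?rhs")
proof -
  have Un: "L \<times> \<Sigma> \<union> (N - L) \<times> \<Sigma> = N \<times> \<Sigma>" using assms(1) by auto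
  have tr: "transitions L \<Sigma> (restrict \<delta> (L \<times> \<Sigma>)) = transitions L \<Sigma> \<delta>" for \<delta>
    by (rule transitions_cong) simp
  show ?thesis
  proof (intro equalityI subsetI)
    fix \<delta> assume \<delta>: "\<delta> \<in> ?lhs"
    have val: "\<delta> (q, a) \<in> L \<union> Z" if "q \<in> N" "a \<in> \<Sigma>" for q a
    proof -
      have "\<delta> (q, a) \<in> N \<union> Z"
        using \<delta> that by (auto simp: acyclic_transitions_def PiE_iff)
      moreover have "\<delta> (q, a) \<notin> N - L"
        using \<delta> that by (auto simp: sources_def)
      ultimately show ?thesis by auto
    qed
    have "(q, q) \<notin> (transitions L \<Sigma> \<delta>)\<^sup>+" if "q \<in> L" for q
    proof
      assume "(q, q) \<in> (transitions L \<Sigma> \<delta>)\<^sup>+"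
      moreover have "transitions L \<Sigma> \<delta> \<subseteq> transitions N \<Sigma> \<delta>"
        using assms(1) by (auto simp: transitions_def)
      ultimately have "(q, q) \<in> (transitions N \<Sigma> \<delta>)\<^sup>+"
        by (rule trancl_mono)
      with \<delta> that assms(1) show False by (auto simp: acyclic_transitions_def)
    qed
    with \<delta> val assms(1) show "\<delta> \<in> ?rhs"
      by (auto simp: Un acyclic_transitions_def tr PiE_iff)
  next
    fix \<delta> assume \<delta>: "\<delta> \<in> ?rhs"
    have val: "\<delta> (q, a) \<in> L \<union> Z" if "q \<in> N" "a \<in> \<Sigma>" for q a
      using \<delta> that by (cases "q \<in> L") (auto simp: acyclic_transitions_def PiE_iff)
    then have src: "N - L \<subseteq> sources \<Sigma> N \<delta>"
      using assms(2) by (auto simp: sources_def)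
    have "(q, q) \<notin> (transitions N \<Sigma> \<delta>)\<^sup>+" if "q \<in> N" for q
    proof
      assume cyc: "(q, q) \<in> (transitions N \<Sigma> \<delta>)\<^sup>+"
      then have "q \<in> \<delta> ` (N \<times> \<Sigma>)"
        by (cases rule: trancl.cases) (auto simp: transitions_def)
      with that src have "q \<in> L" by (auto simp: sources_def)
      with trancl_avoids_sources[OF cyc _ src] \<delta> show False
        by (auto simp: acyclic_transitions_def tr)
    qed
    with \<delta> val assms(1) src show "\<delta> \<in> ?lhs"
      by (auto simp: Un acyclic_transitions_def PiE_iff)
  qed
qed

lemma card_acyclic_transitions_with_sources:
  assumes "finite \<Sigma>" "finite Z" "finite N" "L \<subseteq> N" "N \<inter> Z = {}"
  shows "card {\<delta> \<in> acyclic_transitions \<Sigma> Z N. N - L \<subseteq> sources \<Sigma> N \<delta>} =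
    card (acyclic_transitions \<Sigma> Z L) * ((card L + card Z) ^ card \<Sigma>) ^ card (N - L)"
proof -
  have "card ((N - L) \<times> \<Sigma> \<rightarrow>\<^sub>E L \<union> Z) = card (L \<union> Z) ^ (card (N - L) * card \<Sigma>)"
    using assms by (subst card_funcsetE) (auto simp: card_cartesian_product)
  moreover have "card (L \<union> Z) = card L + card Z"
    using assms by (intro card_Un_disjoint) (auto intro: finite_subset)
  moreover have "card {\<delta> \<in> extensional (L \<times> \<Sigma> \<union> (N - L) \<times> \<Sigma>). 
       restrict \<delta> (L \<times> \<Sigma>) \<in> acyclic_transitions \<Sigma> Z L \<and>
       restrict \<delta> ((N - L) \<times> \<Sigma>) \<in> (N - L) \<times> \<Sigma> \<rightarrow>\<^sub>E L \<union> Z} =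
       card (acyclic_transitions \<Sigma> Z L) * card ((N - L) \<times> \<Sigma> \<rightarrow>\<^sub>E L \<union> Z)"
    by (rule card_glued_functions) (auto simp: acyclic_transitions_def PiE_iff)
  ultimately show ?thesis
    using assms by (simp add: acyclic_transitions_with_sources power_mult mult.commute)
qed

lemma sum_Pow_alternating:
  assumes "finite A"
  shows "(\<Sum>S\<in>Pow A. (- 1) ^ card S) = (0 :: int) ^ card A"
  using prod_diff_conv_sum[OF assms, of "\<lambda>_. 1 :: int" "\<lambda>_. 1"] by simp

text \<open>
  Up to its sign, each summand counts the transition functions for which all
  states of \<open>S = N - L\<close> are sources. Exchanging the sums leaves, for each transition function,
  the alternating sum over the subsets of its set of sources.
\<close>

lemma acyclic_transitions_recurrence:
  assumes "finite \<Sigma>" "finite Z" "finite N" "N \<inter> Z = {}"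
  shows "(\<Sum>L\<in>Pow N. int (card (acyclic_transitions \<Sigma> Z L)) *
           (- int ((card L + card Z) ^ card \<Sigma>)) ^ card (N - L)) = 0 ^ card N"
proof -
  let ?D = "acyclic_transitions \<Sigma> Z N"
  have finD: "finite ?D" using assms by (intro finite_acyclic_transitions)
  have "(\<Sum>L\<in>Pow N. int (card (acyclic_transitions \<Sigma> Z L)) *
           (- int ((card L + card Z) ^ card \<Sigma>)) ^ card (N - L)) =
        (\<Sum>L\<in>Pow N. (- 1) ^ card (N - L) *
           int (card {\<delta> \<in> ?D. N - L \<subseteq> sources \<Sigma> N \<delta>}))"
    using assms by (intro sum.cong[OF refl])
      (auto simp: card_acyclic_transitions_with_sources power_minus[of "(_ + _) ^ _"])
  also have "\<dots> = (\<Sum>S\<in>Pow N. (- 1) ^ card S * int (card {\<delta> \<in> ?D. S \<subseteq> sources \<Sigma> N \<delta>}))"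
    by (rule sum.reindex_bij_witness[of _ "\<lambda>S. N - S" "\<lambda>S. N - S"]) (auto simp: double_diff)
  also have "\<dots> = (\<Sum>S\<in>Pow N. \<Sum>\<delta>\<in>?D. if S \<subseteq> sources \<Sigma> N \<delta> then (- 1) ^ card S else 0)"
    using finD by (intro sum.cong[OF refl]) (simp add: sum.If_cases Int_def mult.commute)
  also have "\<dots> = (\<Sum>\<delta>\<in>?D. \<Sum>S\<in>Pow N. if S \<subseteq> sources \<Sigma> N \<delta> then (- 1) ^ card S else 0)"
    by (rule sum.swap)
  also have "\<dots> = (\<Sum>\<delta>\<in>?D. \<Sum>S\<in>Pow (sources \<Sigma> N \<delta>). (- 1) ^ card S)"
  proof (rule sum.cong[OF refl])
    fix \<delta>
    have "sources \<Sigma> N \<delta> \<subseteq> N" by (auto simp: sources_def)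
    then have "{S \<in> Pow N. S \<subseteq> sources \<Sigma> N \<delta>} = Pow (sources \<Sigma> N \<delta>)" by auto
    with assms(3) show "(\<Sum>S\<in>Pow N. if S \<subseteq> sources \<Sigma> N \<delta> then (- 1) ^ card S else (0::int)) =
       (\<Sum>S\<in>Pow (sources \<Sigma> N \<delta>). (- 1) ^ card S)"
      by (simp add: sum.inter_filter[symmetric])
  qed
  also have "\<dots> = (\<Sum>\<delta>\<in>?D. 0 ^ card (sources \<Sigma> N \<delta>))"
    using assms(3) by (intro sum.cong[OF refl] sum_Pow_alternating) (simp add: sources_def)
  also have "\<dots> = 0 ^ card N"
  proof (cases "N = {}")
    case True
    then have "?D = {\<lambda>_. undefined}"
      by (auto simp: acyclic_transitions_def)
    with True show ?thesis by (simp add: sources_def)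
  next
    case False
    have "(0::int) ^ card (sources \<Sigma> N \<delta>) = 0" if "\<delta> \<in> ?D" for \<delta>
      proof -
      have "finite (sources \<Sigma> N \<delta>)" using assms(3) by (simp add: sources_def)
      then show ?thesis
        using ex_source[OF assms(3) False that] by (simp add: card_gt_0_iff)
    qed
    then have "(\<Sum>\<delta>\<in>?D. (0::int) ^ card (sources \<Sigma> N \<delta>)) = 0"
      by (intro sum.neutral) blast
    with False assms(3) show ?thesis by (simp add: card_gt_0_iff)
  qed
  finally show ?thesis .
qed

text \<open>
  The factor \<open>2 ^ card N\<close> for the accepting states splits as \<open>2 ^ card L * 2 ^ card (N - L)\<close>
  between the automaton on \<open>L\<close> and the attached sources.
\<close>

lemma extended_ADFA_recurrence:
  assumes "finite \<Sigma>" "finite T" "finite N" "N \<inter> T = {}" "e \<notin> N" "e \<notin> T"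
  shows "(\<Sum>L\<in>Pow N. int (card (extended_ADFA \<Sigma> T e L)) *
           (- int (2 * (Suc (card L) + card T) ^ card \<Sigma>)) ^ card (N - L)) = 0 ^ card N"
proof -
  have "(\<Sum>L\<in>Pow N. int (card (extended_ADFA \<Sigma> T e L)) *
           (- int (2 * (Suc (card L) + card T) ^ card \<Sigma>)) ^ card (N - L)) =
    (\<Sum>L\<in>Pow N. 2 ^ card N * (int (card (acyclic_transitions \<Sigma> (insert e T) L)) *
           (- int ((card L + card (insert e T)) ^ card \<Sigma>)) ^ card (N - L)))"
  proof (rule sum.cong[OF refl])
    fix L assume "L \<in> Pow N"
    then have L: "L \<subseteq> N" "finite L" using assms(3) by (auto intro: finite_subset)
    then have "card N = card L + card (N - L)"
      using assms(3) by (simp add: card_Diff_subset card_mono)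
    moreover have "- int (2 * (Suc (card L) + card T) ^ card \<Sigma>) =
        2 * (- int ((card L + card (insert e T)) ^ card \<Sigma>))"
      using assms by simp
    moreover have "int (card (extended_ADFA \<Sigma> T e L)) =
        2 ^ card L * int (card (acyclic_transitions \<Sigma> (insert e T) L))"
      using L by (simp add: extended_ADFA_eq card_cartesian_product card_Pow)
    ultimately show "int (card (extended_ADFA \<Sigma> T e L)) *
           (- int (2 * (Suc (card L) + card T) ^ card \<Sigma>)) ^ card (N - L) =
      2 ^ card N * (int (card (acyclic_transitions \<Sigma> (insert e T) L)) *
           (- int ((card L + card (insert e T)) ^ card \<Sigma>)) ^ card (N - L))"
      by (simp only: power_mult_distrib power_add mult_ac)
  qed
  also have "\<dots> = 2 ^ card N * 0 ^ card N"
    using assms by (simp only: sum_distrib_left[symmetric])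
      (subst acyclic_transitions_recurrence, auto)
  also have "\<dots> = 0 ^ card N" by (cases "card N") auto
  finally show ?thesis .
qed

section \<open>The bijection\<close>

theorem theorem2:
  fixes k t n :: nat and \<Sigma> :: "'s set" and T N :: "'a set" and e :: 'a
  assumes "k \<ge> 1"
    and "finite \<Sigma>" "card \<Sigma> = k"
    and "finite T" "card T = t"
    and "finite N" "card N = n"
    and "N \<inter> T = {}" "e \<notin> N" "e \<notin> T"
  shows "\<exists>\<Phi>. bij_betw \<Phi> (parking_functions (\<lambda>m. 2 * (m + t) ^ k) N) (extended_ADFA \<Sigma> T e N)"
proof -
  let ?\<chi> = "\<lambda>m. 2 * (m + t) ^ k"
  have "int (card (parking_functions ?\<chi> N)) = int (card (extended_ADFA \<Sigma> T e N))"
  proof (rule subset_recurrence_unique[OF \<open>finite N\<close>,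
        where c = "\<lambda>L M. (- int (?\<chi> (Suc (card L)))) ^ card (M - L)"])
    fix M assume "M \<subseteq> N"
    with assms have M: "finite M" "M \<inter> T = {}" "e \<notin> M" by (auto intro: finite_subset)
    show "(\<Sum>L\<in>Pow M. int (card (parking_functions ?\<chi> L)) * (- int (?\<chi> (Suc (card L)))) ^ card (M - L))
        = (\<Sum>L\<in>Pow M. int (card (extended_ADFA \<Sigma> T e L)) * (- int (?\<chi> (Suc (card L)))) ^ card (M - L))"
      using parking_functions_recurrence[OF mono_two_mult_power M(1), of t k]
        extended_ADFA_recurrence[OF \<open>finite \<Sigma>\<close> \<open>finite T\<close> M \<open>e \<notin> T\<close>] assms(3,5)
      by simp
  qed simp
  moreover have "finite (extended_ADFA \<Sigma> T e N)"
    using assms by (simp add: extended_ADFA_eq finite_acyclic_transitions)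
  ultimately show ?thesis
    using finite_parking_functions[OF \<open>finite N\<close>, of ?\<chi>]
    by (intro finite_same_card_bij) auto
qed

end
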